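(* Let $A_1\in\mathbb{R}^{m_1\times m_1}$, $B_1\in\mathbb{R}^{m_1\times 1}$, $C_1\in\mathbb{R}^{1\times m_1}$, and put $$A=\begin{bmatrix}A_1 & B_1\\ 0 & 0\end{bmatrix},\quad B=\begin{bmatrix}-B_1\\ 0\end{bmatrix},\quad E=\begin{bmatrix}\mathbf{0}_{m_1\times 1}\\ 1\end{bmatrix},\quad C=\begin{bmatrix}C_1 & 1\end{bmatrix}.$$ Consider the extended system, with state $\mathbf{x}_\ell^i=\begin{bmatrix}X_\ell^1\\ f_\ell^i\end{bmatrix}\in\mathbb{R}^{m_1+1}$, $$\dot{\mathbf{x}}_\ell^i = A\mathbf{x}_\ell^i + B\widetilde{\mu}_\ell^i + E\dot f_\ell^i,\qquad \widetilde{\nu}_\ell^i = C\mathbf{x}_\ell^i,$$ where $\widetilde{\mu}_\ell^i$ and $\widetilde{\nu}_\ell^i$ are the scalar signals received by agent $i$ from agent $\ell$, and the fault $f_\ell^i$ is an arbitrary unknown piecewise differentiable scalar signal. Consider also the observer $$\dot{\mathbf{z}}_\ell^i = F\mathbf{z}_\ell^i + TB\,\widetilde{\mu}_\ell^i + K\,\widetilde{\nu}_\ell^i,\qquad \widehat{\mathbf{x}}_\ell^i=\mathbf{z}_\ell^i+H\,\widetilde{\nu}_\ell^i,$$ with $F,T\in\mathbb{R}^{(m_1+1)\times(m_1+1)}$ and $K,H\in\mathbb{R}^{(m_1+1)\times 1}$. Suppose that the matrices $F$, $H$, $T$ and $K=K_1+K_2$ are selected such that $$(HC-I)E=0,\qquad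 T=I-HC,\qquad F=A-HCA-K_1C,\qquad K_2=FH,$$ and $K_1$ is selected such that $F$ is strictly stable (all its eigenvalues have negative real part). Then the estimation error $\widetilde{\mathbf{x}}_\ell^i=\mathbf{x}_\ell^i-\widehat{\mathbf{x}}_\ell^i$ is exponentially stable.
   Context: Setting. Agents are the nodes of a connected undirected graph; $\mathcal{N}_i$ denotes the set of neighbors of agent $i$, and $\mathcal{M}_i\subseteq\mathcal{N}_i$ the subset of neighbors from which agent $i$ receives faulty data. Each agent $\ell$ runs the internally stable average consensus (ISAC) estimator, part of whose dynamics is $$\dot X_\ell^1=A_1X_\ell^1-B_1\mu_\ell,\qquad \nu_\ell=C_1X_\ell^1,$$ where $X_\ell^1(t)\in\mathbb{R}^{m_1}$ is a (continuous) internal state and $\nu_\ell,\mu_\ell$ are scalar signals. The signal $\mu_\ell$ is given by $\dot X_\ell^2=A_2X_\ell^2+B_2\sum_{j\in\mathcal{N}_\ell}(\nu_\ell-\nu_j)$ and $\mu_\ell=C_2X_\ell^2+D_2\sum_{j\in\mathcal{N}_\ell}(\nu_\ell-\nu_j)-\phi_\ell$, where $X_\ell^2(t)\in\mathbb{R}^{m_2}$ is a second internal state and $\phi_\ell$ is agent $\ell$'s reference input. Each agent $\ell$ communicates $\nu_\ell$ and $\mu_\ell$ to its neighbors. For $\ell\in\mathcal{M}_i$, agent $i$ receives the corrupted signals $\widetilde\nu_\ell^i=\nu_\ell+f_\ell^i$ and $\widetilde\mu_\ell^i=\mu_\ell+f_\ell^i$, with the same scalar fault $f_\ell^i$ in both.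 Substituting $\mu_\ell=\widetilde\mu_\ell^i-f_\ell^i$ gives the extended system in the claim. No functional form and no bound on $f_\ell^i$ is assumed, only that it is piecewise differentiable; the equation for $\dot{\mathbf{x}}_\ell^i$ is understood at the times where $f_\ell^i$ is differentiable. $I$ is the identity matrix of size $m_1+1$. "The estimation error is exponentially stable" means that there are constants $c,\alpha>0$, independent of the initial conditions and of the signals $f_\ell^i,\widetilde\mu_\ell^i$, such that $\|\widetilde{\mathbf{x}}_\ell^i(t)\|\le c\,e^{-\alpha t}\|\widetilde{\mathbf{x}}_\ell^i(0)\|$ for all $t\ge 0$. *)

theory Defs
  imports "HOL-Analysis.Analysis"
begin

(* Block notation.  A matrix 'a^'c^'r is a vector of rows, so vstack serves both for
   vectors and for matrices. *)

definition vstack :: "'a ^ 'n \<Rightarrow> 'a ^ 'p \<Rightarrow> 'a ^ ('n::finite + 'p::finite)" where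
  "vstack x y = (\<chi> i. case i of Inl j \<Rightarrow> x $ j | Inr j \<Rightarrow> y $ j)"

definition hstack :: "'a ^ 'n ^ 'r \<Rightarrow> 'a ^ 'p ^ 'r \<Rightarrow> 'a ^ ('n::finite + 'p::finite) ^ 'r::finite" where
  "hstack P Q = (\<chi> i. vstack (P $ i) (Q $ i))"

(* Eigenvalues of a real matrix are complex: they are taken over the complexification. *)

definition complex_eigenvalue :: "real ^ 'n ^ 'n \<Rightarrow> complex \<Rightarrow> bool" where
  "complex_eigenvalue M l \<longleftrightarrow>
     (\<exists>v :: complex ^ 'n. v \<noteq> 0 \<and> map_matrix complex_of_real M *v v = l *s v)"

definition strictly_stable :: "real ^ 'n ^ 'n \<Rightarrow> bool" where
  "strictly_stable M \<longleftrightarrow> (\<forall>l. complex_eigenvalue M l \<longrightarrow> Re l < 0)"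

(* Time runs over the half-line {0..}; derivatives at 0 are one-sided.  The library's
   piecewise_differentiable_on is not used: it demands continuity and finitely many exceptional
   points on the whole domain, whereas a fault may jump, and may do so infinitely often as long
   as there are finitely many exceptional times in each bounded interval. *)

definition differentiability_times :: "(real \<Rightarrow> real) \<Rightarrow> real set" where
  "differentiability_times f = {t. 0 \<le> t \<and> f differentiable (at t within {0..})}"

definition piecewise_differentiable :: "(real \<Rightarrow> real) \<Rightarrow> bool" where
  "piecewise_differentiable f \<longleftrightarrow> (\<forall>b. finite ({0..b} - differentiability_times f))"

(* Scalars and one-component vectors are identified through vec, so that the column matrices
   B, E, K, H can act on scalar signals. *)

definition extended_state ::
    "(real \<Rightarrow> real ^ 'n) \<Rightarrow> (real \<Rightarrow> real) \<Rightarrow> real \<Rightarrow> real ^ ('n::finite + 1)" where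
  "extended_state X f t = vstack (X t) (vec (f t))"

(* X is the internal state, f the fault, \<mu> and \<nu> the received (corrupted) signals.
   X is continuous, while f, hence also \<mu>, \<nu> and the extended state, may jump. *)

definition extended_system ::
    "real ^ ('n + 1) ^ ('n + 1) \<Rightarrow> real ^ 1 ^ ('n + 1) \<Rightarrow> real ^ 1 ^ ('n + 1) \<Rightarrow>
     real ^ ('n + 1) ^ 1 \<Rightarrow>
     (real \<Rightarrow> real ^ 'n) \<Rightarrow> (real \<Rightarrow> real) \<Rightarrow> (real \<Rightarrow> real) \<Rightarrow> (real \<Rightarrow> real) \<Rightarrow> bool" where
  "extended_system A B E C X f \<mu> \<nu> \<longleftrightarrow>
     continuous_on {0..} X \<and>
     piecewise_differentiable f \<and>
     (\<forall>t \<in> differentiability_times f. \<forall>f'.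
        (f has_real_derivative f') (at t within {0..}) \<longrightarrow>
        (extended_state X f has_vector_derivative
           A *v extended_state X f t + B *v vec (\<mu> t) + E *v vec f') (at t within {0..})) \<and>
     (\<forall>t \<ge> 0. vec (\<nu> t) = C *v extended_state X f t)"

(* The inputs \<mu> and \<nu> may jump where f is not differentiable, so a solution of the observer
   equation is a continuous z satisfying it at all other times, collected in D. *)

definition observer ::
    "real ^ 'm ^ 'm \<Rightarrow> real ^ 'm ^ 'm \<Rightarrow> real ^ 1 ^ 'm \<Rightarrow> real ^ 1 ^ 'm \<Rightarrow>
     real set \<Rightarrow> (real \<Rightarrow> real) \<Rightarrow> (real \<Rightarrow> real) \<Rightarrow> (real \<Rightarrow> real ^ 'm) \<Rightarrow> bool" where
  "observer F T B K D \<mu> \<nu> z \<longleftrightarrow>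
     continuous_on {0..} z \<and>
     (\<forall>t \<in> D. (z has_vector_derivative
        F *v z t + (T ** B) *v vec (\<mu> t) + K *v vec (\<nu> t)) (at t within {0..}))"

definition state_estimate ::
    "real ^ 1 ^ 'm \<Rightarrow> (real \<Rightarrow> real) \<Rightarrow> (real \<Rightarrow> real ^ 'm) \<Rightarrow> real \<Rightarrow> real ^ 'm" where
  "state_estimate H \<nu> z t = z t + H *v vec (\<nu> t)"

(* A property of the set of all possible error trajectories: c and \<alpha> are common to all of them,
   i.e. independent of initial conditions and of the signals. *)

definition exponentially_stable :: "(real \<Rightarrow> 'a::real_normed_vector) set \<Rightarrow> bool" where
  "exponentially_stable \<E> \<longleftrightarrow>
     (\<exists>c > 0. \<exists>\<alpha> > 0. \<forall>e \<in> \<E>. \<forall>t \<ge> 0. norm (e t) \<le> c * exp (- \<alpha> * t) * norm (e 0))"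

end

theory Submission
  imports Defs "HOL-Computational_Algebra.Fundamental_Theorem_Algebra"
begin

text \<open>
  The hypothesis \<open>(HC - I) E = 0\<close> says \<open>T E = 0\<close>, so the error \<open>T x - z\<close> does not depend on the
  fault: it is continuous even where the fault jumps, and at all other times the choice of \<open>F\<close>
  and \<open>K\<close> gives \<open>e' = F e\<close>. It remains to find a Lyapunov form for the stable matrix \<open>F\<close>. Over the
  complex numbers some product \<open>(F - l\<^sub>1) \<dots> (F - l\<^sub>k)\<close> over eigenvalues vanishes; with
  \<open>x\<^sub>0 = x\<close> and \<open>x\<^sub>j = (F - l\<^sub>j) x\<^bsub>j-1\<^esub>\<close>, a suitably weighted sum of the squared norms of the \<open>x\<^sub>j\<close>
  decays along trajectories.
\<close>

section \<open>Annihilating products over eigenvalues\<close>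

text \<open>This is \<open>p(M) x\<close>, evaluated by Horner's scheme directly on the
  vector.\<close>

definition poly_act :: "'a::field ^ 'n ^ 'n \<Rightarrow> 'a poly \<Rightarrow> 'a ^ 'n \<Rightarrow> 'a ^ 'n" where
  "poly_act M p x = fold_coeffs (\<lambda>a y. a *s x + M *v y) p 0"

lemma poly_act_0 [simp]: "poly_act M 0 x = 0"
  by (simp add: poly_act_def)

lemma poly_act_pCons [simp]: "poly_act M (pCons a p) x = a *s x + M *v poly_act M p x"
  by (cases "p = 0 \<and> a = 0") (auto simp: poly_act_def)

lemma poly_act_add: "poly_act M (p + q) x = poly_act M p x + poly_act M q x"
proof (induction p arbitrary: q)
  case 0
  then show ?case by simp
next
  case (pCons a p)
  then show ?case
    by (cases q) (simp add: matrix_vector_right_distrib vector_sadd_rdistrib)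
qed

lemma poly_act_sum: "poly_act M (\<Sum>i\<in>I. p i) x = (\<Sum>i\<in>I. poly_act M (p i) x)"
  by (induction I rule: infinite_finite_induct) (simp_all add: poly_act_add)

lemma poly_act_smult: "poly_act M (smult c p) x = c *s poly_act M p x"
  by (induction p) (simp_all add: vector_scalar_commute vector_add_ldistrib vector_smult_assoc)

lemma poly_act_monom: "poly_act M (monom a k) x = a *s (matrix_vector_mult M ^^ k) x"
  by (induction k) (simp_all add: monom_0 monom_Suc vector_scalar_commute)

lemma poly_act_linear_factor:
  "poly_act M ([:-r, 1:] * q) x = M *v poly_act M q x - r *s poly_act M q x"
proof -
  have "[:-r, 1:] * q = smult (-r) q + pCons 0 q"
    by simp
  then show ?thesis
    by (simp only: poly_act_add poly_act_smult poly_act_pCons) (simp add: vector_smult_lneg)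
qed

text \<open>The head of the list acts first, so removing it replaces \<open>x\<close> by
  \<open>M *v x - r *s x\<close>; the inductions below use this form.\<close>

abbreviation factors_act :: "'a::field ^ 'n ^ 'n \<Rightarrow> 'a list \<Rightarrow> 'a ^ 'n \<Rightarrow> 'a ^ 'n" where
  "factors_act M rs x \<equiv> fold (\<lambda>r y. M *v y - r *s y) rs x"

text \<open>Polynomials in \<open>M\<close> commute, so the innermost factor can be moved
  outermost.\<close>

lemma factors_act_commute:
  "factors_act M rs (M *v x - r *s x) = M *v factors_act M rs x - r *s factors_act M rs x"
proof (induction rs arbitrary: x)
  case Nil
  then show ?case by simp
next
  case (Cons s rs)
  have "M *v (M *v x - r *s x) - s *s (M *v x - r *s x) =
        M *v (M *v x - s *s x) - r *s (M *v x - s *s x)"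
    by (simp add: matrix_vector_mult_diff_distrib vector_scalar_commute vector_ssub_ldistrib
        vector_smult_assoc mult.commute)
  then show ?case by (simp only: fold_Cons o_apply Cons.IH)
qed

lemma factors_act_eq_poly_act:
  "factors_act M rs x = poly_act M (\<Prod>r\<leftarrow>rs. [:-r, 1:]) x"
proof (induction rs arbitrary: x)
  case Nil
  then show ?case by (simp add: one_pCons)
next
  case (Cons r rs)
  then show ?case
    by (simp only: fold_Cons o_apply factors_act_commute list.map prod_list.Cons
        poly_act_linear_factor)
qed

text \<open>The powers of \<open>M\<close> up to the real dimension of the matrix space outnumber
  that dimension, so a nontrivial real combination of them vanishes.\<close>

lemma annihilating_polynomial:
  fixes M :: "complex ^ 'n ^ 'n"
  shows "\<exists>p. p \<noteq> 0 \<and> (\<forall>x. poly_act M p x = 0)"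
proof -
  define pow where "pow k = (matrix_matrix_mult M ^^ k) (mat 1)" for k
  have pow_act: "pow k *v x = (matrix_vector_mult M ^^ k) x" for k x
    unfolding pow_def by (induction k) (simp_all flip: matrix_vector_mul_assoc)
  let ?I = "{..DIM(complex ^ 'n ^ 'n)}"
  show ?thesis
  \<comment> \<open>If two powers coincide, the set of powers may be too small for the dimension
    count; their difference then gives the polynomial.\<close>
  proof (cases "inj_on pow ?I")
    case True
    then have "card (pow ` ?I) = Suc DIM(complex ^ 'n ^ 'n)"
      by (simp add: card_image)
    then have "dependent (pow ` ?I)"
      by (intro dependent_biggerset) simp
    then obtain u where u: "(\<Sum>v\<in>pow ` ?I. u v *\<^sub>R v) = 0" "\<exists>v\<in>pow ` ?I. u v \<noteq> 0"
      by (subst (asm) dependent_finite) auto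
    define p where "p = (\<Sum>k\<in>?I. monom (complex_of_real (u (pow k))) k)"
    obtain k where k: "k \<in> ?I" "u (pow k) \<noteq> 0"
      using u(2) by auto
    have "coeff p k = complex_of_real (u (pow k))"
      using k(1) by (simp add: p_def coeff_sum coeff_monom)
    then have "p \<noteq> 0"
      using k(2) by auto
    moreover have "poly_act M p x = 0" for x
    proof -
      have "poly_act M p x = (\<Sum>k\<in>?I. complex_of_real (u (pow k)) *s (pow k *v x))"
        by (simp add: p_def poly_act_sum poly_act_monom pow_act)
      also have "\<dots> = (\<Sum>k\<in>?I. (u (pow k) *\<^sub>R pow k) *v x)"
        by (intro sum.cong refl)
          (simp add: vec_eq_iff matrix_vector_mult_def scaleR_conv_of_real[where 'a = complex]
            sum_distrib_left mult.assoc)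
      also have "\<dots> = (\<Sum>k\<in>?I. u (pow k) *\<^sub>R pow k) *v x"
        by (simp add: vec_eq_iff matrix_vector_mult_def sum_distrib_right sum.swap[of _ UNIV])
      also have "(\<Sum>k\<in>?I. u (pow k) *\<^sub>R pow k) = 0"
        using u(1) unfolding sum.reindex[OF True] o_def .
      finally show ?thesis by simp
    qed
    ultimately show ?thesis by blast
  next
    case False
    then obtain i j where ij: "i \<noteq> j" "pow i = pow j"
      by (auto simp: inj_on_def)
    define p where "p = monom (1::complex) i + monom (-1) j"
    have "coeff p i = 1"
      using ij by (simp add: p_def coeff_monom)
    then have "p \<noteq> 0"
      by auto
    moreover have "poly_act M p x = 0" for x
      using ij(2) by (simp add: p_def poly_act_add poly_act_monom vector_smult_lneg flip: pow_act)
    ultimately show ?thesis by blast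
  qed
qed

text \<open>Split an annihilating polynomial into linear factors. If \<open>r\<close> is not an
  eigenvalue, \<open>M - r\<close> is injective, so its factor can be cancelled.\<close>

lemma annihilating_eigenvalues:
  fixes M :: "complex ^ 'n ^ 'n"
  shows "\<exists>rs. (\<forall>r\<in>set rs. \<exists>v. v \<noteq> 0 \<and> M *v v = r *s v) \<and> (\<forall>x. factors_act M rs x = 0)"
proof -
  define eig where "eig r \<longleftrightarrow> (\<exists>v. v \<noteq> 0 \<and> M *v v = r *s v)" for r
  obtain p where p: "p \<noteq> 0" "\<And>x. poly_act M p x = 0"
    using annihilating_polynomial[of M] by blast
  obtain R where R: "p = smult (lead_coeff p) (\<Prod>r\<in>#R. [:-r, 1:])"
    using alg_closed_imp_factorization[OF p(1)] by blast
  obtain rs where rs: "mset rs = R"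
    using ex_mset by blast
  have "p = smult (lead_coeff p) (\<Prod>r\<leftarrow>rs. [:-r, 1:])"
    using R by (simp flip: rs mset_map add: prod_mset_prod_list)
  then have "lead_coeff p *s factors_act M rs x = 0" for x
    using p(2)[of x] by (metis factors_act_eq_poly_act poly_act_smult)
  then have "factors_act M rs x = 0" for x
    using p(1) by (simp add: vec_eq_iff)
  moreover have "factors_act M rs x = 0 \<Longrightarrow> factors_act M (filter eig rs) x = 0" for x
  proof (induction rs arbitrary: x)
    case (Cons r rs)
    show ?case
    proof (cases "eig r")
      case True
      then show ?thesis using Cons by simp
    next
      case False
      \<comment> \<open>With the factor of \<open>r\<close> moved outermost, the remaining product
        applied to \<open>x\<close> would be an eigenvector for \<open>r\<close> unless it is
        zero.\<close>
      have "M *v factors_act M rs x = r *s factors_act M rs x"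
        using Cons.prems by (simp add: factors_act_commute)
      then have "factors_act M rs x = 0"
        using False unfolding eig_def by blast
      then show ?thesis using Cons.IH False by simp
    qed
  qed simp
  ultimately have "\<forall>x. factors_act M (filter eig rs) x = 0"
    by blast
  moreover have "\<forall>r\<in>set (filter eig rs). \<exists>v. v \<noteq> 0 \<and> M *v v = r *s v"
    by (simp add: eig_def)
  ultimately show ?thesis by blast
qed

section \<open>Lyapunov forms\<close>

text \<open>The inner product here is the real part of the Hermitian one, and \<open>x\<close> is
  orthogonal to its multiple by the imaginary unit.\<close>

lemma inner_complex_vec_smult: "x \<bullet> (r *s x) = Re r * (norm x)\<^sup>2" for x :: "complex ^ 'n"
proof -
  have "(x $ i) \<bullet> (r * x $ i) = Re r * (x $ i \<bullet> x $ i)" for i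
    by (simp add: inner_complex_def algebra_simps)
  then show ?thesis
    by (simp add: power2_norm_eq_inner inner_vec_def sum_distrib_left)
qed

text \<open>Restricting decay to the kernel makes the induction work: if \<open>r # rs\<close>
  annihilates \<open>x\<close>, then \<open>rs\<close> annihilates \<open>N x\<close>, so the
  inductive form decays there and can absorb the cross term \<open>x \<bullet> N x\<close>.\<close>

lemma lyapunov_form_on_kernel:
  fixes M :: "complex ^ 'n ^ 'n"
  assumes "\<forall>r\<in>set rs. Re r < 0"
  shows "\<exists>Q a. bilinear Q \<and> (\<forall>x y. Q x y = Q y x) \<and> (\<forall>x. (norm x)\<^sup>2 \<le> Q x x) \<and> a > 0 \<and>
           (\<forall>x. factors_act M rs x = 0 \<longrightarrow> Q x (M *v x) \<le> - a * (norm x)\<^sup>2)"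
  using assms
proof (induction rs)
  case Nil
  \<comment> \<open>The empty product is the identity, so its kernel is zero and any rate will
    do.\<close>
  have "bilinear (\<lambda>x y :: complex ^ 'n. x \<bullet> y)"
    by (simp add: bilinear_conv_bounded_bilinear bounded_bilinear_inner)
  then show ?case
    by (intro exI[of _ "\<lambda>x y. x \<bullet> y"] exI[of _ 1])
      (auto simp: inner_commute power2_norm_eq_inner)
next
  case (Cons r rs)
  then obtain Q a where Q: "bilinear Q" "\<And>x y. Q x y = Q y x" "\<And>x. (norm x)\<^sup>2 \<le> Q x x"
    and a: "a > 0" "\<And>x. factors_act M rs x = 0 \<Longrightarrow> Q x (M *v x) \<le> - a * (norm x)\<^sup>2"
    by auto
  define N where "N x = M *v x - r *s x" for x
  define s where "s = - Re r"
  have s: "s > 0"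
    using Cons.prems by (simp add: s_def)
  \<comment> \<open>This makes \<open>k * a = 1 / (2 * s)\<close>, the weight of
    \<open>(norm (N x))\<^sup>2\<close> in the completed square below.\<close>
  define k where "k = 1 / (2 * s * a)"
  have k: "k > 0"
    using s a by (simp add: k_def)
  define P where "P x y = x \<bullet> y + k * Q (N x) (N y)" for x y
  have linN: "linear N"
    unfolding N_def
    by (rule linearI) (simp_all add: vec_eq_iff matrix_vector_mult_def algebra_simps
        sum.distrib scaleR_sum_right)
  have "bilinear P"
    unfolding bilinear_def P_def
    by (intro conjI allI linearI)
      (simp_all add: linear_add[OF linN] linear_scale[OF linN] bilinear_ladd[OF Q(1)]
        bilinear_radd[OF Q(1)] bilinear_lmul[OF Q(1)] bilinear_rmul[OF Q(1)] inner_add_left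
        inner_add_right algebra_simps)
  moreover have "P x y = P y x" for x y
    by (simp add: P_def Q(2)[of "N x"] inner_commute)
  moreover have "(norm x)\<^sup>2 \<le> P x x" for x
  proof -
    have "0 \<le> Q (N x) (N x)"
      using Q(3)[of "N x"] by (smt (verit) zero_le_power2)
    then show ?thesis
      using k by (simp add: P_def power2_norm_eq_inner)
  qed
  moreover have "P x (M *v x) \<le> - (s / 2) * (norm x)\<^sup>2" if x: "factors_act M (r # rs) x = 0" for x
  proof -
    have NM: "N (M *v x) = M *v N x"
      by (simp add: N_def matrix_vector_mult_diff_distrib vector_scalar_commute)
    have "Q (N x) (M *v N x) \<le> - a * (norm (N x))\<^sup>2"
      using x by (intro a(2)) (simp add: N_def)
    then have "k * Q (N x) (M *v N x) \<le> k * (- a * (norm (N x))\<^sup>2)"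
      using k by (intro mult_left_mono) auto
    also have "\<dots> = - ((norm (N x))\<^sup>2 / (2 * s))"
      using s a by (simp add: k_def field_simps)
    finally have 1: "k * Q (N x) (M *v N x) \<le> - ((norm (N x))\<^sup>2 / (2 * s))" .
    have "x \<bullet> (M *v x) = x \<bullet> (r *s x) + x \<bullet> N x"
      by (simp add: N_def flip: inner_add_right)
    also have "\<dots> \<le> - s * (norm x)\<^sup>2 + norm x * norm (N x)"
      unfolding inner_complex_vec_smult s_def using norm_cauchy_schwarz[of x "N x"] by simp
    finally have 2: "x \<bullet> (M *v x) \<le> - s * (norm x)\<^sup>2 + norm x * norm (N x)" .
    \<comment> \<open>Completing the square bounds the cross term at the cost of half the decay rate
      \<open>s\<close>.\<close>
    have "0 \<le> (s * norm x - norm (N x))\<^sup>2 / (2 * s)"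
      using s by simp
    also have "\<dots> = s / 2 * (norm x)\<^sup>2 - norm x * norm (N x) + (norm (N x))\<^sup>2 / (2 * s)"
      using s by (simp add: field_simps power2_eq_square)
    finally show ?thesis
      using 1 2 by (simp add: P_def NM)
  qed
  moreover have "s / 2 > 0"
    using s by simp
  ultimately show ?case by blast
qed

text \<open>Over the complex numbers the eigenvalue product annihilates everything, so the kernel is
  the whole space. The form is pulled back along the embedding of real vectors, which is isometric
  and intertwines \<open>F\<close> with its complexification.\<close>

lemma strictly_stable_lyapunov_form:
  fixes F :: "real ^ 'n ^ 'n"
  assumes "strictly_stable F"
  shows "\<exists>Q a. bounded_bilinear Q \<and> (\<forall>x y. Q x y = Q y x) \<and> (\<forall>x. (norm x)\<^sup>2 \<le> Q x x) \<and> a > 0 \<and>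
           (\<forall>x. Q x (F *v x) \<le> - a * (norm x)\<^sup>2)"
proof -
  let ?M = "map_matrix complex_of_real F"
  obtain rs where rs: "\<forall>r\<in>set rs. \<exists>v. v \<noteq> 0 \<and> ?M *v v = r *s v" "\<And>x. factors_act ?M rs x = 0"
    using annihilating_eigenvalues[of ?M] by blast
  have "\<forall>r\<in>set rs. Re r < 0"
    using rs(1) assms unfolding strictly_stable_def complex_eigenvalue_def by blast
  from lyapunov_form_on_kernel[OF this, of ?M] rs(2) obtain Q a where
    Q: "bilinear Q" "\<And>x y. Q x y = Q y x" "\<And>x. (norm x)\<^sup>2 \<le> Q x x" "a > 0"
    "\<And>x. Q x (?M *v x) \<le> - a * (norm x)\<^sup>2"
    by auto
  define c :: "real ^ 'n \<Rightarrow> complex ^ 'n" where "c x = (\<chi> i. complex_of_real (x $ i))" for x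
  have c_norm: "norm (c x) = norm x" for x
    by (simp add: c_def norm_vec_def)
  have c_act: "c (F *v x) = ?M *v c x" for x
    by (simp add: c_def vec_eq_iff matrix_vector_mult_def)
  have "linear c"
    unfolding c_def by (rule linearI) (simp_all add: vec_eq_iff scaleR_conv_of_real[where 'a = complex])
  then have "bounded_linear c"
    by (simp add: linear_conv_bounded_linear)
  then have "bounded_bilinear (\<lambda>x y. Q (c x) (c y))"
    using Q(1) by (auto simp: bilinear_conv_bounded_bilinear intro: bounded_bilinear.comp)
  then show ?thesis
    using Q(2-5) c_norm c_act by (intro exI[of _ "\<lambda>x y. Q (c x) (c y)"] exI[of _ a]) metis
qed

section \<open>Exponential decay\<close>

text \<open>For continuous \<open>V\<close>, the fundamental theorem of calculus tolerates finitely
  many exceptional points, so \<open>V b - V a\<close> is the integral of \<open>V'\<close>.\<close>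

lemma antimono_from_derivative_off_finite:
  fixes V :: "real \<Rightarrow> real"
  assumes "continuous_on {a..b} V" "a \<le> b" "finite S"
    and "\<And>t. t \<in> {a<..<b} - S \<Longrightarrow> (V has_real_derivative V' t) (at t)"
    and "\<And>t. V' t \<le> 0"
  shows "V b \<le> V a"
proof -
  have "(V' has_integral (V b - V a)) {a..b}"
    using assms by (intro fundamental_theorem_of_calculus_interior_strong[of S])
      (auto simp: has_real_derivative_iff_has_vector_derivative)
  then have "((\<lambda>t. - V' t) has_integral - (V b - V a)) {a..b}"
    by (rule has_integral_neg)
  then have "0 \<le> - (V b - V a)"
    by (rule has_integral_nonneg) (use assms(5) in simp)
  then show ?thesis by simp
qed

text \<open>The constants come from the Lyapunov form of \<open>F\<close> alone, hence are common to
  all trajectories; the set \<open>D\<close> may vary with the trajectory.\<close>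

lemma strictly_stable_imp_exponentially_stable:
  fixes F :: "real ^ 'n ^ 'n"
  assumes "strictly_stable F"
    and traj: "\<And>e. e \<in> \<E> \<Longrightarrow> continuous_on {0..} e \<and>
      (\<exists>D. (\<forall>b. finite ({0..b} - D)) \<and>
        (\<forall>t\<in>D. (e has_vector_derivative F *v e t) (at t within {0..})))"
  shows "exponentially_stable \<E>"
proof -
  obtain Q a where "bounded_bilinear Q" and Q: "\<And>x y. Q x y = Q y x" "\<And>x. (norm x)\<^sup>2 \<le> Q x x"
    and a: "a > 0" "\<And>x. Q x (F *v x) \<le> - a * (norm x)\<^sup>2"
    using strictly_stable_lyapunov_form[OF assms(1)] by auto
  interpret bounded_bilinear Q by fact
  obtain B where B: "B > 0" "\<And>x y. norm (Q x y) \<le> norm x * norm y * B"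
    using pos_bounded by blast
  have QB: "Q x x \<le> B * (norm x)\<^sup>2" for x
    using B(2)[of x x] by (simp add: power2_eq_square mult_ac)
  \<comment> \<open>Since \<open>Q x x \<le> B * (norm x)\<^sup>2\<close>, decay at rate
    \<open>a\<close> in the norm gives decay at rate \<open>a / B\<close> in
    \<open>Q\<close>.\<close>
  define k where "k = a / B"
  have k: "k > 0"
    using a B by (simp add: k_def)
  have decay: "k * Q x x + Q x (F *v x) \<le> 0" for x
  proof -
    have "k * Q x x \<le> k * (B * (norm x)\<^sup>2)"
      using k QB by (intro mult_left_mono) auto
    also have "\<dots> = a * (norm x)\<^sup>2"
      using B by (simp add: k_def)
    finally show ?thesis
      using a(2)[of x] by simp
  qed
  have "norm (e t) \<le> sqrt B * exp (- k * t) * norm (e 0)" if e: "e \<in> \<E>" and t: "t \<ge> 0" for e t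
  proof -
    obtain D where cont: "continuous_on {0..} e" and fin: "\<And>b. finite ({0..b} - D)"
      and ode: "\<And>t. t \<in> D \<Longrightarrow> (e has_vector_derivative F *v e t) (at t within {0..})"
      using traj[OF e] by auto
    \<comment> \<open>The derivative of \<open>Q (e s) (e s)\<close> is at most
      \<open>-2 * k\<close> times itself, so this exponential weight makes \<open>V\<close>
      nonincreasing.\<close>
    define V where "V s = exp (2 * k * s) * Q (e s) (e s)" for s
    define V' where "V' s = 2 * exp (2 * k * s) * (k * Q (e s) (e s) + Q (e s) (F *v e s))" for s
    have "V t \<le> V 0"
    proof (rule antimono_from_derivative_off_finite[of 0 t V "{0..t} - D" V'])
      have "continuous_on {0..t} e"
        using cont by (rule continuous_on_subset) auto
      then show "continuous_on {0..t} V"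
        unfolding V_def by (intro continuous_intros continuous_on)
      show "V' s \<le> 0" for s
        using decay[of "e s"] by (simp add: V'_def mult_nonneg_nonpos)
      show "(V has_real_derivative V' s) (at s)" if "s \<in> {0<..<t} - ({0..t} - D)" for s
      proof -
        \<comment> \<open>Away from time 0 the derivative within the half-line is two-sided.\<close>
        have "s \<in> D" and "s \<in> interior {0..}"
          using that by auto
        then have de: "(e has_vector_derivative F *v e s) (at s)"
          using ode at_within_interior by metis
        have "((\<lambda>s. Q (e s) (e s)) has_real_derivative Q (e s) (F *v e s) + Q (F *v e s) (e s)) (at s)"
          using has_vector_derivative[OF de de] by (simp add: has_real_derivative_iff_has_vector_derivative)
        then show ?thesis
          unfolding V_def V'_def
          by (auto intro!: derivative_eq_intros simp: Q(1)[of "F *v e s"] algebra_simps)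
      qed
    qed (use t fin in auto)
    then have "Q (e t) (e t) \<le> exp (- (2 * k * t)) * Q (e 0) (e 0)"
      by (simp add: V_def exp_minus field_simps)
    also have "\<dots> \<le> exp (- (2 * k * t)) * (B * (norm (e 0))\<^sup>2)"
      using QB by (intro mult_left_mono) auto
    also have "\<dots> = (sqrt B * exp (- k * t) * norm (e 0))\<^sup>2"
      using B by (simp add: power_mult_distrib mult_ac flip: exp_double)
    finally have "(norm (e t))\<^sup>2 \<le> (sqrt B * exp (- k * t) * norm (e 0))\<^sup>2"
      using Q(2)[of "e t"] by simp
    then show ?thesis
      by (rule power2_le_imp_le) (use B in simp)
  qed
  then show ?thesis
    unfolding exponentially_stable_def using B k
    by (intro exI[of _ "sqrt B"] exI[of _ k]) auto
qed

section \<open>The estimation error\<close>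

lemma vstack_eq_add: "vstack x y = vstack x 0 + vstack 0 y"
  for x :: "'a::comm_monoid_add ^ 'n" and y :: "'a ^ 'p"
  by (simp add: vstack_def vec_eq_iff split: sum.split)

lemma linear_vstack_0: "linear (\<lambda>x :: real ^ 'n. vstack x (0 :: real ^ 'p))"
  by (rule linearI) (simp_all add: vstack_def vec_eq_iff split: sum.split)

text \<open>The left factor is \<open>E\<close>: the fault component of the extended state lies in
  the range of \<open>E\<close>, which \<open>T\<close> annihilates.\<close>

lemma vstack_0_mat_1_vec: "vstack 0 (mat 1 :: real ^ 1 ^ 1) *v vec a = vstack (0 :: real ^ 'n) (vec a)"
  by (simp add: vec_eq_iff vstack_def matrix_vector_mult_def mat_def split: sum.split)

text \<open>The inputs \<open>m\<close> cancel and \<open>T E = 0\<close> removes \<open>f\<close>.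
  The rest follows from \<open>T A = F + K1 C\<close> and \<open>F T = F - K2 C\<close>.\<close>

lemma error_derivative:
  fixes A F T :: "real ^ 'm ^ 'm" and B E K K1 K2 H :: "real ^ 1 ^ 'm" and C :: "real ^ 'm ^ 1"
  assumes "T ** E = 0" "T = mat 1 - H ** C" "F = A - H ** C ** A - K1 ** C" "K2 = F ** H" "K = K1 + K2"
  shows "T *v (A *v x + B *v m + E *v f) - (F *v z + (T ** B) *v m + K *v (C *v x)) = F *v (T *v x - z)"
proof -
  have "T *v (E *v f) = 0"
    by (simp add: matrix_vector_mul_assoc assms(1))
  moreover have "F *v (T *v x) = F *v x - K2 *v (C *v x)"
    by (simp add: assms(2,4) matrix_vector_mult_diff_distrib matrix_vector_mult_diff_rdistrib
        flip: matrix_vector_mul_assoc)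
  moreover have "T *v (A *v x) = F *v x + K1 *v (C *v x)"
    by (simp add: assms(2,3) matrix_vector_mult_diff_rdistrib flip: matrix_vector_mul_assoc)
  ultimately show ?thesis
    by (simp add: assms(5) matrix_vector_right_distrib matrix_vector_mult_diff_distrib
        matrix_vector_mult_add_rdistrib flip: matrix_vector_mul_assoc)
qed

theorem theorem1:
  fixes A1 :: "real ^ 'n ^ 'n" and B1 :: "real ^ 1 ^ 'n" and C1 :: "real ^ 'n ^ 1"
    and A F T :: "real ^ ('n + 1) ^ ('n + 1)"
    and B E K K1 K2 H :: "real ^ 1 ^ ('n + 1)"
    and C :: "real ^ ('n + 1) ^ 1"
  assumes A: "A = vstack (hstack A1 B1) (hstack 0 0)"
    and B: "B = vstack (- B1) 0"
    and E: "E = vstack 0 (mat 1)"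
    and C: "C = hstack C1 (mat 1)"
    and HCE: "(H ** C - mat 1) ** E = 0"
    and T: "T = mat 1 - H ** C"
    and F: "F = A - H ** C ** A - K1 ** C"
    and K2: "K2 = F ** H"
    and K: "K = K1 + K2"
    and stable: "strictly_stable F"
  shows "exponentially_stable
    {\<lambda>t. extended_state X f t - state_estimate H \<nu> z t | X f \<mu> \<nu> z.
       extended_system A B E C X f \<mu> \<nu> \<and>
       observer F T B K (differentiability_times f) \<mu> \<nu> z}"
proof (rule strictly_stable_imp_exponentially_stable[OF stable])
  fix e
  assume "e \<in> {\<lambda>t. extended_state X f t - state_estimate H \<nu> z t | X f \<mu> \<nu> z.
       extended_system A B E C X f \<mu> \<nu> \<and>
       observer F T B K (differentiability_times f) \<mu> \<nu> z}"
  then obtain X f \<mu> \<nu> z where e: "e = (\<lambda>t. extended_state X f t - state_estimate H \<nu> z t)"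
    and sys: "extended_system A B E C X f \<mu> \<nu>"
    and obs: "observer F T B K (differentiability_times f) \<mu> \<nu> z"
    by blast
  let ?D = "differentiability_times f"
  let ?x = "extended_state X f"
  have TE: "T ** E = 0"
  proof -
    have "T ** E = - ((H ** C - mat 1) ** E)"
      unfolding T by (simp add: vec_eq_iff matrix_matrix_mult_def algebra_simps flip: sum_negf)
    then show ?thesis using HCE by simp
  qed
  have \<nu>: "vec (\<nu> t) = C *v ?x t" if "t \<ge> 0" for t
    using sys that by (simp add: extended_system_def)
  \<comment> \<open>Substituting \<nu> = C x into the estimate turns \<open>x - H C x\<close> into
    \<open>T x\<close>; the output equation holds only for nonnegative times.\<close>
  have e_eq: "e t = T *v ?x t - z t" if "t \<ge> 0" for t
    by (simp add: e state_estimate_def \<nu>[OF that] T matrix_vector_mult_diff_rdistrib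
        flip: matrix_vector_mul_assoc)
  \<comment> \<open>Only the continuous part \<open>X\<close> of the extended state survives
    \<open>T\<close>, so jumps of the fault leave the error continuous.\<close>
  have Tx: "T *v ?x t = T *v vstack (X t) 0" for t
  proof -
    have "T *v (E *v vec (f t)) = 0"
      by (simp add: matrix_vector_mul_assoc TE)
    then show ?thesis
      by (simp add: E vstack_0_mat_1_vec extended_state_def vstack_eq_add[of "X t" "vec _"]
          matrix_vector_right_distrib)
  qed
  have "continuous_on {0..} (\<lambda>t. T *v vstack (X t) 0 - z t)"
  proof -
    have "continuous_on {0..} X" "continuous_on {0..} z"
      using sys obs by (simp_all add: extended_system_def observer_def)
    then show ?thesis
      by (intro continuous_intros linear_continuous_on_compose[OF _ linear_vstack_0]
          linear_continuous_on_compose[OF _ matrix_vector_mul_linear])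
  qed
  then have "continuous_on {0..} e"
    by (rule continuous_on_eq) (simp add: e_eq Tx)
  moreover have "\<forall>b. finite ({0..b} - ?D)"
    using sys by (simp add: extended_system_def piecewise_differentiable_def)
  moreover have "(e has_vector_derivative F *v e t) (at t within {0..})" if t: "t \<in> ?D" for t
  proof -
    have t0: "t \<ge> 0"
      using t by (simp add: differentiability_times_def)
    obtain f' where "(f has_real_derivative f') (at t within {0..})"
      using t by (auto simp: differentiability_times_def real_differentiable_def)
    then have dx: "(?x has_vector_derivative A *v ?x t + B *v vec (\<mu> t) + E *v vec f') (at t within {0..})"
      using sys t by (auto simp: extended_system_def)
    have dz: "(z has_vector_derivative F *v z t + (T ** B) *v vec (\<mu> t) + K *v vec (\<nu> t)) (at t within {0..})"
      using obs t by (simp add: observer_def)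
    have "((\<lambda>t. T *v ?x t - z t) has_vector_derivative
            T *v (A *v ?x t + B *v vec (\<mu> t) + E *v vec f')
            - (F *v z t + (T ** B) *v vec (\<mu> t) + K *v vec (\<nu> t))) (at t within {0..})"
      by (intro has_vector_derivative_diff dz
          bounded_linear.has_vector_derivative[OF matrix_vector_mul_bounded_linear dx])
    then have "((\<lambda>t. T *v ?x t - z t) has_vector_derivative F *v e t) (at t within {0..})"
      unfolding \<nu>[OF t0] error_derivative[OF TE T F K2 K] e_eq[OF t0] .
    \<comment> \<open>The two functions agree only on the half-line, which suffices for a derivative
      within it.\<close>
    then show ?thesis
      by (rule has_vector_derivative_transform[rotated 2]) (use t0 in \<open>auto simp: e_eq\<close>)
  qed
  ultimately show "continuous_on {0..} e \<and> (\<exists>D. (\<forall>b. finite ({0..b} - D)) \<and>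
        (\<forall>t\<in>D. (e has_vector_derivative F *v e t) (at t within {0..})))"
    by blast
qed

end
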